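(* Let $\omega^*$ be a real number for which there exist an integer $n_0\ge 2$ and a bilinear noncommutative algorithm multiplying two $n_0\times n_0$ matrices using at most $n_0^{\omega^*}$ multiplications. For two given $n \times n$ matrices $A$ and $B$ and any $\epsilon > 0$, there exists a MapReduce algorithm computing $A \times B$ with $O(n^{\omega^*(2-\epsilon)/2})$ machines and $O(n^\epsilon)$ memory on each machine, running in $O(\log n)$ rounds.
   Context: A bilinear noncommutative algorithm for multiplying an $p\times q$ matrix $X$ by a $q\times r$ matrix $Y$ with $l$ multiplications consists of $l$ products $M_i=\alpha_i\beta_i$ ($1\le i\le l$), where each $\alpha_i$ is a fixed linear combination of entries of $X$ and each $\beta_i$ a fixed linear combination of entries of $Y$, such that every entry of $XY$ is a fixed linear combination of $M_1,\dots,M_l$, and the identity remains valid when the entries are themselves matrices (noncommuting). The paper uses $\omega^*\approx 2.3728$, the best known bound on the matrix multiplication exponent (Le Gall), which is attained by such an algorithm for some constant $n_0$. MapReduce model: computation proceeds in synchronous rounds; in each round every machine performs arbitrary local computation on its local memory and then machines exchange data (each machine sends/receives at most its memory); the input is initially distributed among the machines; memory counts the words a machine stores.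
   Formalization: The number of machines is bounded by O(max(1, n^{ω*(2-ε)/2})), because for ε > 2 the stated bound would force zero machines for large n; for ε ≤ 2 the two bounds coincide. *)

theory Defs
  imports "Jordan_Normal_Form.Matrix" "HOL-Library.Landau_Symbols"
begin

section \<open>Bilinear noncommutative algorithms\<close>

text \<open>Linear combination of \<open>m \<times> m\<close> matrices; \<^typ>\<open>'a mat\<close> is not a monoid, so the sum is
  written entrywise.\<close>

definition mat_lincomb ::
  "nat \<Rightarrow> 'i set \<Rightarrow> ('i \<Rightarrow> 'a::field) \<Rightarrow> ('i \<Rightarrow> 'a mat) \<Rightarrow> 'a mat" where
  "mat_lincomb m I c X = mat m m (\<lambda>ab. \<Sum>s\<in>I. c s * X s $$ ab)"

text \<open>The entries of the \<open>p \<times> q\<close> matrix \<open>X\<close> and of the \<open>q \<times> r\<close> matrix \<open>Y\<close> are themselves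
  \<open>m \<times> m\<close> matrices, for arbitrary \<open>m\<close> (\<open>m = 1\<close> is the case of scalar entries). The \<open>t\<close>-th product
  is \<open>(\<Sum> \<alpha> t (i, j) X (i, j)) * (\<Sum> \<beta> t (j, k) Y (j, k))\<close>, and entry \<open>(i, k)\<close> of \<open>XY\<close> is recovered
  with the coefficients \<open>\<gamma> (i, k)\<close>.\<close>

definition bilinear_matmul_algorithm ::
  "nat \<Rightarrow> nat \<Rightarrow> nat \<Rightarrow> nat \<Rightarrow> (nat \<Rightarrow> nat \<times> nat \<Rightarrow> 'a::field) \<Rightarrow> (nat \<Rightarrow> nat \<times> nat \<Rightarrow> 'a)
    \<Rightarrow> (nat \<times> nat \<Rightarrow> nat \<Rightarrow> 'a) \<Rightarrow> bool" where
  "bilinear_matmul_algorithm p q r l \<alpha> \<beta> \<gamma> \<longleftrightarrow>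
    (\<forall>m X Y.
      (\<forall>i<p. \<forall>j<q. X (i, j) \<in> carrier_mat m m) \<longrightarrow>
      (\<forall>j<q. \<forall>k<r. Y (j, k) \<in> carrier_mat m m) \<longrightarrow>
      (\<forall>i<p. \<forall>k<r.
        mat_lincomb m {..<q} (\<lambda>_. 1) (\<lambda>j. X (i, j) * Y (j, k)) =
        mat_lincomb m {..<l} (\<gamma> (i, k))
          (\<lambda>t. mat_lincomb m ({..<p} \<times> {..<q}) (\<alpha> t) X * mat_lincomb m ({..<q} \<times> {..<r}) (\<beta> t) Y)))"

section \<open>MapReduce computations\<close>

text \<open>A word holds one field element. In a round, machine \<open>j\<close> turns the list of words in its memory
  into a list of pairs (destination machine, word). What a machine keeps it sends to itself, so this
  list is at once its memory after the local computation and the data it sends.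

  A local computation is free in its running time and in its control flow: which words it produces,
  and where they go, may depend on the memory in an arbitrary way. Each word produced, however, has
  to be obtained from the words in memory by field operations, along one of finitely many computation
  paths. If the values were unrestricted functions of the memory, then over an infinite field a
  single word could encode any number of words and the memory bound would carry no meaning. Over a
  finite field the condition holds for every function of the memory.\<close>

datatype 'a aexp =
    Const 'a
  | Word nat
  | Add "'a aexp" "'a aexp"
  | Neg "'a aexp"
  | Mult "'a aexp" "'a aexp"
  | Inv "'a aexp"

primrec aeval :: "'a::field list \<Rightarrow> 'a aexp \<Rightarrow> 'a" where
  "aeval w (Const c) = c"
| "aeval w (Word i) = (if i < length w then w ! i else 0)"
| "aeval w (Add e f) = aeval w e + aeval w f"
| "aeval w (Neg e) = - aeval w e"
| "aeval w (Mult e f) = aeval w e * aeval w f"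
| "aeval w (Inv e) = inverse (aeval w e)"

definition local_computation :: "nat \<Rightarrow> ('a::field list \<Rightarrow> (nat \<times> 'a) list) \<Rightarrow> bool" where
  "local_computation S f \<longleftrightarrow>
    (\<exists>P. finite P \<and>
      (\<forall>w. length w \<le> S \<longrightarrow> (\<exists>out\<in>P. f w = map (\<lambda>(d, e). (d, aeval w e)) out)))"

text \<open>\<open>prog t j\<close> is the local computation of machine \<open>j\<close> in round \<open>t\<close>, and
  \<open>mr_memory M prog init t j\<close> is the memory of machine \<open>j\<close> after \<open>t\<close> rounds. Received words are
  ordered by sender and, for equal senders, by their position in the sender's list.\<close>

type_synonym 'a mr_program = "nat \<Rightarrow> nat \<Rightarrow> 'a list \<Rightarrow> (nat \<times> 'a) list"

primrec mr_memory :: "nat \<Rightarrow> 'a mr_program \<Rightarrow> (nat \<Rightarrow> 'a list) \<Rightarrow> nat \<Rightarrow> nat \<Rightarrow> 'a list" where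
  "mr_memory M prog init 0 = init"
| "mr_memory M prog init (Suc t) =
    (\<lambda>j. concat (map (\<lambda>i. map snd (filter (\<lambda>(d, _). d = j) (prog t i (mr_memory M prog init t i))))
                     [0..<M]))"

text \<open>Every machine stores, sends and receives at most \<open>S\<close> words in each of the \<open>R\<close> rounds.\<close>

definition mr_within_bounds ::
  "nat \<Rightarrow> nat \<Rightarrow> nat \<Rightarrow> 'a mr_program \<Rightarrow> (nat \<Rightarrow> 'a list) \<Rightarrow> bool" where
  "mr_within_bounds M S R prog init \<longleftrightarrow>
    (\<forall>t\<le>R. \<forall>j<M. length (mr_memory M prog init t j) \<le> S) \<and>
    (\<forall>t<R. \<forall>j<M. let out = prog t j (mr_memory M prog init t j)
                   in length out \<le> S \<and> fst ` set out \<subseteq> {..<M})"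

section \<open>Matrix multiplication in MapReduce\<close>

text \<open>An input layout assigns to each machine the list of positions whose entries it initially holds
  (\<open>Inl (i, j)\<close> for the left factor and \<open>Inr (i, j)\<close> for the right one). Every entry is
  stored exactly once.\<close>

type_synonym mm_layout = "nat \<Rightarrow> (nat \<times> nat + nat \<times> nat) list"

definition mm_input_layout :: "nat \<Rightarrow> nat \<Rightarrow> nat \<Rightarrow> mm_layout \<Rightarrow> bool" where
  "mm_input_layout n M S L \<longleftrightarrow>
    distinct (concat (map L [0..<M])) \<and>
    set (concat (map L [0..<M])) = ({..<n} \<times> {..<n}) <+> ({..<n} \<times> {..<n}) \<and>
    (\<forall>j<M. length (L j) \<le> S)"

definition mm_input :: "'a mat \<Rightarrow> 'a mat \<Rightarrow> mm_layout \<Rightarrow> nat \<Rightarrow> 'a list" where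
  "mm_input A B L j = map (case_sum (($$) A) (($$) B)) (L j)"

text \<open>The output location \<open>loc (i, k)\<close>, a pair (machine, position in its memory), must not depend
  on the matrices.\<close>

definition mr_computes_matmul ::
  "nat \<Rightarrow> nat \<Rightarrow> nat \<Rightarrow> nat \<Rightarrow> mm_layout \<Rightarrow> 'a::field mr_program \<Rightarrow> bool" where
  "mr_computes_matmul n M S R L prog \<longleftrightarrow>
    (\<forall>t<R. \<forall>j<M. local_computation S (prog t j)) \<and>
    (\<exists>loc. \<forall>A\<in>carrier_mat n n. \<forall>B\<in>carrier_mat n n.
      mr_within_bounds M S R prog (mm_input A B L) \<and>
      (\<forall>i<n. \<forall>k<n. case loc (i, k) of (j, pos) \<Rightarrow>
        j < M \<and> pos < length (mr_memory M prog (mm_input A B L) R j) \<and>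
        mr_memory M prog (mm_input A B L) R j ! pos = (A * B) $$ (i, k)))"

end

(*
  Run the bilinear algorithm recursively, but stop after d levels, when the subproblems have side
  m = n^(eps/2), up to constants, and fit into a single machine. There are then
  l^d <= (n/m)^omega = n^(omega(2-eps)/2) subproblems, one per machine. On the way down and on the way
  up every entry is a linear combination of boundedly many entries of the neighbouring level, and enters
  boundedly many of them, so each level costs one round. Spreading each level evenly over the machines
  is enough: level s has l^s (n/n0^s)^2 entries up to a constant, which grows with s because l >= n0^2,
  so the last level, with m^2 entries per machine, determines the memory.
*)
theory Submission
  imports Defs "Jordan_Normal_Form.Determinant"
begin

text \<open>The obstacle is that the model limits stored, received and sent words alike and admits
  only words obtained by field operations. All of this is settled on symbolic words (labels) before
  any matrix appears: owners and destinations are fixed in advance, and one expression per label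
  serves all inputs. The leaf multiplication is the one place where fan-in is not bounded by a
  constant, since an entry of a leaf product needs 2m words. Placing all entries of a leaf product
  on one machine lets them share the 2m^2 entries of its two factors. In every other step an entry
  needs at most l words, and past the input every word goes to at most l machines, whence the memory
  2*l*m^2. The inequality l >= n0^2 is not a hypothesis; it is extracted from the algorithm by a
  rank argument, and it also makes the total memory large enough for both inputs. The side n need
  not be m times a power of n0, so the root of the recursion is a zero-padded copy of the
  input.\<close>

text \<open>Multiplication by the identity matrix factors the identity on \<open>q\<^sup>2\<close> coordinates through
  dimension \<open>l\<close>; the factors are padded to square matrices so that determinants apply.\<close>

lemma bilinear_matmul_algorithm_rank:
  fixes \<alpha> \<beta> :: "nat \<Rightarrow> nat \<times> nat \<Rightarrow> 'a::field" and \<gamma> :: "nat \<times> nat \<Rightarrow> nat \<Rightarrow> 'a"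
  assumes alg: "bilinear_matmul_algorithm q q q l \<alpha> \<beta> \<gamma>"
  shows "q\<^sup>2 \<le> l"
proof (rule ccontr)
  assume "\<not> q\<^sup>2 \<le> l"
  then have less: "l < q\<^sup>2" by simp
  define N where "N = q\<^sup>2"
  define \<delta> where "\<delta> t = (\<Sum>s\<in>{..<q} \<times> {..<q}. \<beta> t s * (if fst s = snd s then 1 else 0))" for t
  \<comment> \<open>Scalar entries suffice: \<open>X\<close> is the matrix unit at
    \<open>(a, b)\<close> and \<open>Y\<close> the identity, so \<open>XY\<close> is that matrix
    unit again and \<open>\<delta> t\<close> is the value of the \<open>t\<close>-th right
    factor.\<close>
  have unit: "(\<Sum>t<l. \<gamma> (i, k) t * (\<alpha> t (a, b) * \<delta> t)) = (if (i, k) = (a, b) then 1 else 0)"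
    if "i < q" "k < q" "a < q" "b < q" for i k a b
  proof -
    define X :: "nat \<times> nat \<Rightarrow> 'a mat" where "X s = mat 1 1 (\<lambda>_. if s = (a, b) then 1 else 0)" for s
    define Y :: "nat \<times> nat \<Rightarrow> 'a mat" where "Y s = mat 1 1 (\<lambda>_. if fst s = snd s then 1 else 0)" for s
    have "mat_lincomb 1 {..<q} (\<lambda>_. 1) (\<lambda>j. X (i, j) * Y (j, k)) =
        mat_lincomb 1 {..<l} (\<gamma> (i, k))
          (\<lambda>t. mat_lincomb 1 ({..<q} \<times> {..<q}) (\<alpha> t) X * mat_lincomb 1 ({..<q} \<times> {..<q}) (\<beta> t) Y)"
      using alg[unfolded bilinear_matmul_algorithm_def, rule_format, of X 1 Y i k] that
      by (simp add: X_def Y_def)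
    then have "mat_lincomb 1 {..<q} (\<lambda>_. 1) (\<lambda>j. X (i, j) * Y (j, k)) $$ (0, 0) =
        mat_lincomb 1 {..<l} (\<gamma> (i, k))
          (\<lambda>t. mat_lincomb 1 ({..<q} \<times> {..<q}) (\<alpha> t) X * mat_lincomb 1 ({..<q} \<times> {..<q}) (\<beta> t) Y) $$ (0, 0)"
      by simp
    then have eq: "(\<Sum>j<q. (if (i, j) = (a, b) then 1 else 0) * (if j = k then 1 else 0)) =
        (\<Sum>t<l. \<gamma> (i, k) t * ((\<Sum>s\<in>{..<q} \<times> {..<q}. \<alpha> t s * (if s = (a, b) then 1 else 0)) * \<delta> t))"
      by (simp add: mat_lincomb_def X_def Y_def scalar_prod_def \<delta>_def)
    have "(\<Sum>s\<in>{..<q} \<times> {..<q}. \<alpha> t s * (if s = (a, b) then 1 else 0)) = \<alpha> t (a, b)" for t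
      using that by (subst if_distrib) (simp cong: if_cong)
    moreover have "(\<Sum>j<q. (if (i, j) = (a, b) then 1 else 0) * (if j = k then 1 else 0)) =
        (if (i, k) = (a, b) then 1 else (0::'a))"
      using that by (subst if_distrib) (simp cong: if_cong)
    ultimately show ?thesis using eq by simp
  qed
  define C where "C = mat N N (\<lambda>(r, t). if t < l then \<gamma> (r div q, r mod q) t * \<delta> t else 0)"
  define A where "A = mat N N (\<lambda>(t, c). if t < l then \<alpha> t (c div q, c mod q) else 0)"
  have carr: "C \<in> carrier_mat N N" "A \<in> carrier_mat N N" by (auto simp: C_def A_def)
  have "C * A = 1\<^sub>m N"
  proof (rule eq_matI)
    fix r c assume rc: "r < dim_row (1\<^sub>m N :: 'a mat)" "c < dim_col (1\<^sub>m N :: 'a mat)"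
    then have rN: "r < q * q" "c < q * q" by (auto simp: N_def power2_eq_square)
    then have q: "q > 0" by (cases q) auto
    have bounds: "r div q < q" "c div q < q" "r mod q < q" "c mod q < q"
      using rN q by (auto simp: less_mult_imp_div_less)
    have rceq: "(r div q, r mod q) = (c div q, c mod q) \<longleftrightarrow> r = c"
      by (metis Pair_inject div_mult_mod_eq)
    have "(C * A) $$ (r, c) =
        (\<Sum>t<N. if t < l then \<gamma> (r div q, r mod q) t * \<delta> t * \<alpha> t (c div q, c mod q) else 0)"
      using rc by (simp add: C_def A_def scalar_prod_def lessThan_atLeast0 cong: if_cong)
        (intro sum.cong, auto)
    also have "\<dots> = (\<Sum>t<l. \<gamma> (r div q, r mod q) t * (\<alpha> t (c div q, c mod q) * \<delta> t))"
      using less by (intro sum.mono_neutral_cong_right) (auto simp: N_def mult_ac)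
    also have "\<dots> = (if r = c then 1 else 0)"
      using unit[OF bounds(1,3,2,4)] rceq by simp
    finally show "(C * A) $$ (r, c) = 1\<^sub>m N $$ (r, c)" using rc by simp
  qed (auto simp: C_def A_def)
  then have "det C * det A = 1" using det_mult[OF carr] by simp
  \<comment> \<open>Since \<open>l < N\<close>, row \<open>l\<close> of \<open>A\<close> exists and
    consists of padding only.\<close>
  moreover have "det A = 0"
  proof -
    have "A = mat\<^sub>r N N (\<lambda>t. if t = l then 0\<^sub>v N else row A t)"
      by (rule eq_matI) (auto simp: A_def)
    moreover have "row A \<in> {0..<N} \<rightarrow> carrier_vec N"
      using carr(2) by auto
    ultimately show ?thesis
      using det_row_0[of l N "row A"] less by (simp add: N_def)
  qed
  ultimately show False by simp
qed

section \<open>Oblivious schedules\<close>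

text \<open>The expression is chosen before the valuation: a single formula has to be right for all
  admissible inputs, which makes it usable as a fixed program.\<close>

definition expressible :: "('b \<Rightarrow> 'a::field) set \<Rightarrow> 'b list \<Rightarrow> (('b \<Rightarrow> 'a) \<Rightarrow> 'a) \<Rightarrow> bool" where
  "expressible V xs g \<longleftrightarrow> (\<exists>e. \<forall>v\<in>V. aeval (map v xs) e = g v)"

lemma expressible_const: "expressible V xs (\<lambda>_. c)"
  unfolding expressible_def by (rule exI[of _ "Const c"]) simp

lemma expressible_member: "y \<in> set xs \<Longrightarrow> expressible V xs (\<lambda>v. v y)"
proof -
  assume "y \<in> set xs"
  then obtain i where "i < length xs" "xs ! i = y" by (auto simp: in_set_conv_nth)
  then show ?thesis
    unfolding expressible_def by (intro exI[of _ "Word i"]) simp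
qed

lemma expressible_add:
  "expressible V xs f \<Longrightarrow> expressible V xs g \<Longrightarrow> expressible V xs (\<lambda>v. f v + g v)"
  unfolding expressible_def by (metis aeval.simps(3))

lemma expressible_mult:
  "expressible V xs f \<Longrightarrow> expressible V xs g \<Longrightarrow> expressible V xs (\<lambda>v. f v * g v)"
  unfolding expressible_def by (metis aeval.simps(5))

lemma expressible_sum:
  "(\<And>i. i \<in> I \<Longrightarrow> expressible V xs (f i)) \<Longrightarrow> expressible V xs (\<lambda>v. \<Sum>i\<in>I. f i v)"
  by (induction I rule: infinite_finite_induct) (auto intro: expressible_const expressible_add)

lemma expressible_cong:
  "expressible V xs f \<Longrightarrow> (\<And>v. v \<in> V \<Longrightarrow> f v = g v) \<Longrightarrow> expressible V xs g"
  unfolding expressible_def by auto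

text \<open>The words of a computation are named by labels. A label is computed by its owner from the
  labels it needs, which have to reach that machine in the round before; hence a label is sent
  to the owners of all labels that need it.\<close>

locale oblivious_schedule =
  fixes M S :: nat and D :: "'b set" and stage own :: "'b \<Rightarrow> nat" and needs :: "'b \<Rightarrow> 'b set"
    and init :: "nat \<Rightarrow> 'b list" and V :: "('b \<Rightarrow> 'a::field) set"
  assumes finite_labels: "finite D"
    and own_less: "y \<in> D \<Longrightarrow> own y < M"
    and needs_label: "z \<in> D \<Longrightarrow> y \<in> needs z \<Longrightarrow> y \<in> D \<and> Suc (stage y) = stage z"
    and init_own: "y \<in> D \<Longrightarrow> stage y = 0 \<Longrightarrow> y \<in> set (init (own y))"
    and init_length: "j < M \<Longrightarrow> length (init j) \<le> S"
    and load: "j < M \<Longrightarrow> card (\<Union>z\<in>{z \<in> D. stage z = Suc t \<and> own z = j}. needs z) \<le> S"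
    and send: "i < M \<Longrightarrow>
      card (SIGMA y:{y \<in> D. stage y = t \<and> own y = i}. own ` {z \<in> D. y \<in> needs z}) \<le> S"
    and compute: "y \<in> D \<Longrightarrow> stage y > 0 \<Longrightarrow> needs y \<subseteq> set xs \<Longrightarrow> expressible V xs (\<lambda>v. v y)"
begin

text \<open>A set of pairs, so a word wanted by several labels of one machine is sent there once. At
  the leaves this matters: a factor entry enters \<open>m\<close> products, all on the same
  machine.\<close>

definition messages :: "nat \<Rightarrow> nat \<Rightarrow> (nat \<times> 'b) set" where
  "messages t i =
    prod.swap ` (SIGMA y:{y \<in> D. stage y = t \<and> own y = i}. own ` {z \<in> D. y \<in> needs z})"

lemma mem_messages:
  "(j, y) \<in> messages t i \<longleftrightarrow> y \<in> D \<and> stage y = t \<and> own y = i \<and> (\<exists>z\<in>D. y \<in> needs z \<and> own z = j)"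
  by (force simp: messages_def)

lemma finite_messages: "finite (messages t i)"
  using finite_labels by (auto simp: messages_def)

definition message_list :: "nat \<Rightarrow> nat \<Rightarrow> (nat \<times> 'b) list" where
  "message_list t i = (SOME xs. set xs = messages t i \<and> distinct xs)"

lemma message_list: "set (message_list t i) = messages t i" "distinct (message_list t i)"
  using someI_ex[OF finite_distinct_list[OF finite_messages[of t i]]]
  unfolding message_list_def by auto

lemma length_message_list:
  assumes "i < M"
  shows "length (message_list t i) \<le> S"
proof -
  have "length (message_list t i) = card (messages t i)"
    using message_list[of t i] distinct_card by metis
  also have "\<dots> \<le> S"
    using send[OF assms, of t] by (simp add: messages_def card_image)
  finally show ?thesis .
qed

text \<open>The semantics of the model is polymorphic in the words, so it can be run on labels
  themselves; actual memories turn out to be images of this run under a valuation.\<close>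

abbreviation symbolic_memory :: "nat \<Rightarrow> nat \<Rightarrow> 'b list" where
  "symbolic_memory \<equiv> mr_memory M (\<lambda>t i _. message_list t i) init"

text \<open>A label is evaluated only in the round in which it is sent. After \<open>Suc t\<close>
  rounds a machine thus holds the ingredients of its labels of stage \<open>Suc t\<close>, not these
  labels.\<close>

lemma set_symbolic_memory_Suc:
  "set (symbolic_memory (Suc t) j) = (\<Union>z\<in>{z \<in> D. stage z = Suc t \<and> own z = j}. needs z)"
  (is "?L = ?R")
proof -
  have "y \<in> ?L \<longleftrightarrow> (\<exists>i<M. (j, y) \<in> messages t i)" for y
    by (force simp: message_list)
  also have "(\<exists>i<M. (j, y) \<in> messages t i) \<longleftrightarrow> y \<in> ?R" for y
    unfolding mem_messages using needs_label own_less by auto (metis Suc_inject)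
  finally show ?thesis by blast
qed

text \<open>A label is sent only by its owner, so different senders contribute different labels.
  This turns the cardinality bound \<open>load\<close> into a bound on the length of the
  memory.\<close>

lemma distinct_symbolic_memory_Suc: "distinct (symbolic_memory (Suc t) j)"
proof -
  define f where "f i = map snd (filter (\<lambda>(d, _). d = j) (message_list t i))" for i
  have dist: "distinct (f i)" for i
    using message_list(2)[of t i] by (auto simp: f_def distinct_map inj_on_def)
  have f_own: "own y = i" if "y \<in> set (f i)" for y i
    using that by (auto simp: f_def message_list mem_messages)
  have "distinct (concat (map f xs))" if "distinct xs" for xs
    using that by (induction xs) (auto simp: dist dest: f_own)
  from this[of "[0..<M]"] show ?thesis by (simp add: f_def[abs_def])
qed

lemma length_symbolic_memory: "j < M \<Longrightarrow> length (symbolic_memory t j) \<le> S"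
proof (cases t)
  case 0
  then show "j < M \<Longrightarrow> ?thesis" using init_length by simp
next
  case (Suc s)
  assume "j < M"
  have "length (symbolic_memory t j) = card (set (symbolic_memory t j))"
    unfolding Suc using distinct_symbolic_memory_Suc distinct_card by metis
  then show ?thesis
    unfolding Suc set_symbolic_memory_Suc using load[OF \<open>j < M\<close>, of s] by simp
qed

lemma expressible_message:
  assumes "(j, y) \<in> messages t i"
  shows "expressible V (symbolic_memory t i) (\<lambda>v. v y)"
proof -
  have y: "y \<in> D" "stage y = t" "own y = i" using assms by (auto simp: mem_messages)
  show ?thesis
  proof (cases t)
    case 0
    then show ?thesis using y init_own[of y] by (auto intro: expressible_member)
  next
    case (Suc s)
    show ?thesis
      by (rule compute[OF y(1)], use y Suc in simp, unfold Suc set_symbolic_memory_Suc)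
        (use y Suc in auto)
  qed
qed

definition message_expr :: "nat \<Rightarrow> nat \<Rightarrow> 'b \<Rightarrow> 'a aexp" where
  "message_expr t i y = (SOME e. \<forall>v\<in>V. aeval (map v (symbolic_memory t i)) e = v y)"

lemma aeval_message_expr:
  assumes "(j, y) \<in> messages t i" "v \<in> V"
  shows "aeval (map v (symbolic_memory t i)) (message_expr t i y) = v y"
  using someI_ex[OF expressible_message[OF assms(1), unfolded expressible_def]] assms(2)
  unfolding message_expr_def by blast

definition program :: "'a mr_program" where
  "program t i w = map (\<lambda>(j, y). (j, aeval w (message_expr t i y))) (message_list t i)"

text \<open>Destinations and expressions do not depend on the memory contents, so a single
  computation path suffices.\<close>

lemma local_computation_program: "local_computation S (program t i)"
  unfolding local_computation_def
  by (rule exI[of _ "{map (\<lambda>(j, y). (j, message_expr t i y)) (message_list t i)}"])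
    (auto simp: program_def)

lemma program_symbolic_memory:
  assumes "v \<in> V"
  shows "program t i (map v (symbolic_memory t i)) = map (\<lambda>(j, y). (j, v y)) (message_list t i)"
  unfolding program_def using aeval_message_expr[OF _ assms] message_list by fastforce

text \<open>Simulation: evaluating labels commutes with routing them, because destinations are fixed
  and, for valuations in \<open>V\<close>, the chosen expressions return the intended
  values.\<close>

lemma mr_memory_program:
  assumes "v \<in> V"
  shows "mr_memory M program (\<lambda>j. map v (init j)) t = (\<lambda>j. map v (symbolic_memory t j))"
proof (induction t)
  case (Suc t)
  have "map snd (filter (\<lambda>(d, _). d = j) (map (\<lambda>(j, y). (j, v y)) xs)) =
      map v (map snd (filter (\<lambda>(d, _). d = j) xs))" for j and xs :: "(nat \<times> 'b) list"
    by (induction xs) auto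
  then show ?case
    by (simp add: Suc program_symbolic_memory[OF assms] map_concat comp_def)
qed simp

lemma mr_within_bounds_program:
  assumes "v \<in> V"
  shows "mr_within_bounds M S R program (\<lambda>j. map v (init j))"
proof -
  have "fst ` set (message_list t i) \<subseteq> {..<M}" for t i
    using own_less by (auto simp: message_list mem_messages)
  then show ?thesis
    unfolding mr_within_bounds_def mr_memory_program[OF assms]
    by (auto simp: Let_def program_symbolic_memory[OF assms] length_symbolic_memory
        length_message_list image_image split_beta)
qed

end

section \<open>Recursive bilinear multiplication\<close>

definition block :: "nat \<Rightarrow> 'a mat \<Rightarrow> nat \<times> nat \<Rightarrow> 'a mat" where
  "block h A ab = mat h h (\<lambda>(i, j). A $$ (fst ab * h + i, snd ab * h + j))"

lemma mult_add_less_mult: "a < q \<Longrightarrow> i < h \<Longrightarrow> a * h + i < q * (h::nat)"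
proof -
  assume "a < q" "i < h"
  then have "a * h + i < Suc a * h" by simp
  also have "\<dots> \<le> q * h" using \<open>a < q\<close> by (intro mult_le_mono1) simp
  finally show ?thesis .
qed

text \<open>The noncommutative identity is applied with \<open>h \<times> h\<close> blocks as
  entries; summing the block products over \<open>j\<close> regroups the inner index
  \<open>x\<close> by \<open>x div h\<close>.\<close>

lemma matmul_block_recursion:
  fixes A B :: "'a::field mat"
  assumes alg: "bilinear_matmul_algorithm q q q l \<alpha> \<beta> \<gamma>"
    and A: "A \<in> carrier_mat (q * h) (q * h)" and B: "B \<in> carrier_mat (q * h) (q * h)"
    and ik: "i < q * h" "k < q * h"
  shows "(A * B) $$ (i, k) = (\<Sum>t<l. \<gamma> (i div h, k div h) t *
    (mat_lincomb h ({..<q} \<times> {..<q}) (\<alpha> t) (block h A) *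
     mat_lincomb h ({..<q} \<times> {..<q}) (\<beta> t) (block h B)) $$ (i mod h, k mod h))" (is "_ = ?R")
proof -
  have h: "h > 0" using ik by (cases h) auto
  have bounds: "i div h < q" "k div h < q" "i mod h < h" "k mod h < h"
    using ik h by (auto simp: less_mult_imp_div_less)
  let ?P = "\<lambda>j. block h A (i div h, j) * block h B (j, k div h)"
  have "mat_lincomb h {..<q} (\<lambda>_. 1) ?P = mat_lincomb h {..<l} (\<gamma> (i div h, k div h))
      (\<lambda>t. mat_lincomb h ({..<q} \<times> {..<q}) (\<alpha> t) (block h A) *
        mat_lincomb h ({..<q} \<times> {..<q}) (\<beta> t) (block h B))"
    using alg[unfolded bilinear_matmul_algorithm_def, rule_format,
        of "block h A" h "block h B" "i div h" "k div h"] bounds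
    by (simp add: block_def)
  then have "mat_lincomb h {..<q} (\<lambda>_. 1) ?P $$ (i mod h, k mod h) = ?R"
    using bounds by (simp add: mat_lincomb_def)
  moreover have "mat_lincomb h {..<q} (\<lambda>_. 1) ?P $$ (i mod h, k mod h) = (\<Sum>j<q. ?P j $$ (i mod h, k mod h))"
    using bounds by (simp add: mat_lincomb_def)
  moreover have "?P j $$ (i mod h, k mod h) = (\<Sum>x\<in>{j * h..<j * h + h}. A $$ (i, x) * B $$ (x, k))" for j
  proof -
    have "?P j $$ (i mod h, k mod h) = (\<Sum>x = 0..<h. A $$ (i, j * h + x) * B $$ (j * h + x, k))"
      using bounds by (simp add: block_def scalar_prod_def)
    then show ?thesis
      using sum.shift_bounds_nat_ivl[of "\<lambda>x. A $$ (i, x) * B $$ (x, k)" 0 "j * h" h]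
      by (simp add: add.commute)
  qed
  moreover have "(A * B) $$ (i, k) = (\<Sum>x<q * h. A $$ (i, x) * B $$ (x, k))"
    using A B ik by (simp add: scalar_prod_def lessThan_atLeast0)
  ultimately show ?thesis
    by (simp add: sum.nat_group)
qed

section \<open>Zero padding and balanced distribution\<close>

definition pad_mat :: "nat \<Rightarrow> nat \<Rightarrow> 'a::zero mat \<Rightarrow> 'a mat" where
  "pad_mat n N A = mat N N (\<lambda>(i, j). if i < n \<and> j < n then A $$ (i, j) else 0)"

lemma pad_mat_carrier: "pad_mat n N A \<in> carrier_mat N N"
  by (simp add: pad_mat_def)

lemma pad_mat_mult:
  fixes A B :: "'a::field mat"
  assumes "A \<in> carrier_mat n n" "B \<in> carrier_mat n n" "n \<le> N" "i < n" "k < n"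
  shows "(pad_mat n N A * pad_mat n N B) $$ (i, k) = (A * B) $$ (i, k)"
proof -
  have "(pad_mat n N A * pad_mat n N B) $$ (i, k) =
      (\<Sum>x\<in>{0..<N}. (if x < n then A $$ (i, x) else 0) * (if x < n then B $$ (x, k) else 0))"
    using assms by (simp add: pad_mat_def scalar_prod_def)
  also have "\<dots> = (\<Sum>x\<in>{0..<n}. A $$ (i, x) * B $$ (x, k))"
    using assms by (intro sum.mono_neutral_cong_right) auto
  finally show ?thesis using assms by (simp add: scalar_prod_def)
qed

text \<open>Number the elements and give each machine \<open>K\<close> consecutive numbers.\<close>

lemma ex_balanced_assignment:
  assumes "finite T" "card T \<le> M * K"
  shows "\<exists>f. (\<forall>y\<in>T. f y < M) \<and> (\<forall>j. card {y \<in> T. f y = j} \<le> (K::nat))"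
proof -
  obtain h where h: "bij_betw h T {0..<card T}"
    using ex_bij_betw_finite_nat[OF assms(1)] by blast
  have h_less: "h y < M * K" if "y \<in> T" for y
    using bij_betw_apply[OF h that] assms(2) by simp
  then have "h y div K < M" if "y \<in> T" for y
    using that by (intro less_mult_imp_div_less) simp
  moreover have "card {y \<in> T. h y div K = j} \<le> K" for j
  proof -
    have "h y \<in> {j * K..<j * K + K}" if "y \<in> T" "h y div K = j" for y
    proof -
      have "K > 0" using h_less[OF that(1)] by (cases K) auto
      then have "h y mod K < K" by simp
      moreover have "h y = j * K + h y mod K" using that(2) by auto
      ultimately show ?thesis by (metis add_less_cancel_left atLeastLessThan_iff le_add1)
    qed
    then have "h ` {y \<in> T. h y div K = j} \<subseteq> {j * K..<j * K + K}" by auto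
    moreover have "inj_on h {y \<in> T. h y div K = j}"
      using h by (auto simp: bij_betw_def inj_on_def)
    ultimately show ?thesis using card_inj_on_le[of h _ "{j * K..<j * K + K}"] by fastforce
  qed
  ultimately show ?thesis by (intro exI[of _ "\<lambda>y. h y div K"]) auto
qed

section \<open>The network of the recursion\<close>

text \<open>A path lists, most recent first, the indices of the bilinear products chosen on the way down the
  recursion tree. \<open>Sub True p\<close> and \<open>Sub False p\<close> are the two factors of the subproblem at
  \<open>p\<close>, and \<open>Prod p\<close> is their product.\<close>

datatype label =
    Inp bool nat nat
  | Sub bool "nat list" nat nat
  | Prod "nat list" nat nat
  | Outp nat nat

text \<open>There is one machine per leaf of the recursion. In the memory bound,
  \<open>2 * m\<^sup>2\<close> is the number of labels of a positive stage that a machine owns, and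
  \<open>l\<close> bounds fan-in and fan-out.\<close>

locale matmul_network =
  fixes q l m d n :: nat
    and \<alpha> \<beta> :: "nat \<Rightarrow> nat \<times> nat \<Rightarrow> 'a::field" and \<gamma> :: "nat \<times> nat \<Rightarrow> nat \<Rightarrow> 'a"
    and L :: mm_layout
  assumes q_pos: "q > 0" and m_pos: "m > 0"
    and alg: "bilinear_matmul_algorithm q q q l \<alpha> \<beta> \<gamma>"
    and n_le: "n \<le> m * q ^ d"
    and layout: "mm_input_layout n (l ^ d) (2 * l * m\<^sup>2) L"
begin

definition side :: "nat \<Rightarrow> nat" where "side s = m * q ^ (d - s)"

lemma side_Suc: "s < d \<Longrightarrow> side s = q * side (Suc s)"
  unfolding side_def by (metis Suc_diff_Suc mult.left_commute power_Suc)

lemma side_pos: "side s > 0"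
  using q_pos m_pos by (simp add: side_def)

lemma side_last: "side d = m"
  by (simp add: side_def)

lemma side_le: "side s \<le> side 0"
  using q_pos by (simp add: side_def power_increasing)

lemma q_le_l: "q\<^sup>2 \<le> l"
  by (rule bilinear_matmul_algorithm_rank[OF alg])

lemma l_pos: "l > 0"
  using q_le_l q_pos by (metis gr0I le_zero_eq power_not_zero not_less0)

definition paths :: "nat \<Rightarrow> nat list set" where
  "paths s = {p. set p \<subseteq> {..<l} \<and> length p = s}"

lemma card_paths: "card (paths s) = l ^ s" "finite (paths s)"
  unfolding paths_def by (simp_all add: card_lists_length_eq finite_lists_length_eq)

lemma paths_side_le:
  assumes "s \<le> d"
  shows "l ^ s * (side s * side s) \<le> l ^ d * m\<^sup>2"
proof -
  have "l ^ s * (side s * side s) = l ^ s * (q\<^sup>2) ^ (d - s) * m\<^sup>2"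
    by (simp add: side_def power2_eq_square power_mult_distrib mult_ac)
  also have "\<dots> \<le> l ^ s * l ^ (d - s) * m\<^sup>2"
    using q_le_l by (intro mult_le_mono power_mono) auto
  also have "\<dots> = l ^ d * m\<^sup>2" using assms by (simp flip: power_add)
  finally show ?thesis .
qed

text \<open>Factors at depth \<open>s\<close> have stage \<open>s + 1\<close>, as stage 0 is the
  input; leaf products follow at \<open>d + 2\<close> and the root product at
  \<open>2 * d + 2\<close>. The last stage performs no arithmetic: it forces the root product to be
  delivered into a memory.\<close>

primrec stage :: "label \<Rightarrow> nat" where
  "stage (Inp b i j) = 0"
| "stage (Sub b p i j) = Suc (length p)"
| "stage (Prod p i k) = 2 * d + 2 - length p"
| "stage (Outp i k) = 2 * d + 3"

primrec valid :: "label \<Rightarrow> bool" where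
  "valid (Inp b i j) \<longleftrightarrow> i < n \<and> j < n"
| "valid (Sub b p i j) \<longleftrightarrow>
    length p \<le> d \<and> p \<in> paths (length p) \<and> i < side (length p) \<and> j < side (length p)"
| "valid (Prod p i k) \<longleftrightarrow>
    length p \<le> d \<and> p \<in> paths (length p) \<and> i < side (length p) \<and> k < side (length p)"
| "valid (Outp i k) \<longleftrightarrow> i < n \<and> k < n"

text \<open>Padding entries need nothing, being the constant 0. Away from the leaves the
  dependencies ignore which coefficients vanish, so they depend on positions only.\<close>

primrec needs :: "label \<Rightarrow> label set" where
  "needs (Inp b i j) = {}"
| "needs (Sub b p i j) = (case p of
      [] \<Rightarrow> if i < n \<and> j < n then {Inp b i j} else {}
    | t # r \<Rightarrow> (\<lambda>(a, c). Sub b r (a * side (length p) + i) (c * side (length p) + j)) ` ({..<q} \<times> {..<q}))"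
| "needs (Prod p i k) =
    (if length p = d then (\<lambda>j. Sub True p i j) ` {..<m} \<union> (\<lambda>j. Sub False p j k) ` {..<m}
     else (\<lambda>t. Prod (t # p) (i mod side (Suc (length p))) (k mod side (Suc (length p)))) ` {..<l})"
| "needs (Outp i k) = {Prod [] i k}"

definition labels :: "label set" where "labels = {y. valid y}"

lemma finite_labels: "finite labels"
proof -
  let ?I = "{..<side 0}" and ?P = "{p. set p \<subseteq> {..<l} \<and> length p \<le> d}"
  have "n \<le> side 0" using n_le by (simp add: side_def)
  then have "valid y \<Longrightarrow> y \<in> (\<lambda>(b, i, j). Inp b i j) ` (UNIV \<times> ?I \<times> ?I) \<union>
      (\<lambda>(b, p, i, j). Sub b p i j) ` (UNIV \<times> ?P \<times> ?I \<times> ?I) \<union>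
      (\<lambda>(p, i, j). Prod p i j) ` (?P \<times> ?I \<times> ?I) \<union> (\<lambda>(i, j). Outp i j) ` (?I \<times> ?I)" for y
    by (cases y) (auto simp: paths_def image_iff intro: less_le_trans[OF _ side_le])
  then have "labels \<subseteq> \<dots>" unfolding labels_def by blast
  then show ?thesis
    by (rule finite_subset) (intro finite_UnI finite_imageI finite_cartesian_product; simp add: finite_lists_length_le)
qed

text \<open>The factor 2 accounts for the two factors on the way down; products and outputs use half
  of it. Stage 0 is excluded because the layout, not the schedule, places the input.\<close>

lemma card_stage:
  assumes "t > 0"
  shows "card {y \<in> labels. stage y = t} \<le> l ^ d * (2 * m\<^sup>2)" (is "card ?T \<le> _")
proof -
  consider "t \<le> Suc d" | "t > Suc d" "t \<le> 2 * d + 2" | "t = 2 * d + 3" | "t > 2 * d + 3" by linarith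
  then show ?thesis
  proof cases
    case 1
    define s where "s = t - 1"
    have s: "s \<le> d" "t = Suc s" using 1 assms by (auto simp: s_def)
    let ?U = "(UNIV :: bool set) \<times> paths s \<times> {..<side s} \<times> {..<side s}"
    have "y \<in> (\<lambda>(b, p, i, j). Sub b p i j) ` ?U" if "y \<in> ?T" for y
      using that s by (cases y) (auto simp: labels_def image_iff)
    then have "?T \<subseteq> (\<lambda>(b, p, i, j). Sub b p i j) ` ?U" by blast
    then have "card ?T \<le> card ?U"
      by (rule surj_card_le[rotated]) (simp add: card_paths)
    also have "\<dots> = 2 * (l ^ s * (side s * side s))"
      by (simp add: card_cartesian_product card_paths)
    finally show ?thesis using paths_side_le[OF s(1)] by simp
  next
    case 2
    define s where "s = 2 * d + 2 - t"
    have s: "s \<le> d" "t = 2 * d + 2 - s" using 2 assms by (auto simp: s_def)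
    let ?U = "paths s \<times> {..<side s} \<times> {..<side s}"
    have "y \<in> (\<lambda>(p, i, j). Prod p i j) ` ?U" if "y \<in> ?T" for y
    proof (cases y)
      case (Prod p i k)
      then have "length p = s" using that s by (auto simp: labels_def)
      then show ?thesis using that Prod by (auto simp: labels_def image_iff)
    qed (use that 2 in \<open>auto simp: labels_def\<close>)
    then have "?T \<subseteq> (\<lambda>(p, i, j). Prod p i j) ` ?U" by blast
    then have "card ?T \<le> card ?U"
      by (rule surj_card_le[rotated]) (simp add: card_paths)
    also have "\<dots> = l ^ s * (side s * side s)"
      by (simp add: card_cartesian_product card_paths)
    finally show ?thesis using paths_side_le[OF s(1)] by simp
  next
    case 3
    let ?U = "{..<n} \<times> {..<n}"
    have "y \<in> (\<lambda>(i, j). Outp i j) ` ?U" if "y \<in> ?T" for y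
      using that 3 by (cases y) (auto simp: labels_def image_iff)
    then have "?T \<subseteq> (\<lambda>(i, j). Outp i j) ` ?U" by blast
    then have "card ?T \<le> card ?U"
      by (rule surj_card_le[rotated]) simp
    also have "\<dots> \<le> side 0 * side 0"
      using n_le by (simp add: card_cartesian_product side_def mult_le_mono)
    finally show ?thesis using paths_side_le[of 0] by simp
  next
    case 4
    have "y \<notin> ?T" for y using 4 by (cases y) (auto simp: labels_def)
    then have "?T = {}" by blast
    then show ?thesis by (simp only: card.empty le0)
  qed
qed

lemma needs_label:
  assumes "z \<in> labels" "y \<in> needs z"
  shows "y \<in> labels \<and> Suc (stage y) = stage z"
proof (cases z)
  case (Sub b p i j)
  show ?thesis
  proof (cases p)
    case Nil
    then show ?thesis using assms Sub by (auto simp: labels_def split: if_splits)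
  next
    case (Cons t r)
    then have "side (length r) = q * side (Suc (length r))"
      using assms Sub by (intro side_Suc) (auto simp: labels_def)
    then show ?thesis using assms Sub Cons
      by (auto simp: labels_def paths_def intro!: mult_add_less_mult)
  qed
next
  case (Prod p i k)
  show ?thesis
  proof (cases "length p = d")
    case True
    then have p: "p \<in> paths d" "i < m" "k < m" using assms Prod by (auto simp: labels_def side_last)
    obtain b a c where "y = Sub b p a c" "a < m" "c < m"
      using assms(2) p(2,3) True by (auto simp: Prod)
    then show ?thesis using p(1) True by (simp add: labels_def side_last Prod)
  next
    case False
    then show ?thesis using assms Prod side_pos
      by (auto simp: labels_def paths_def)
  qed
next
  case (Outp i k)
  then show ?thesis using assms n_le by (auto simp: labels_def paths_def side_def)
qed (use assms in auto)

text \<open>On the way down an entry combines \<open>q\<^sup>2 \<le> l\<close> entries, on the way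
  up \<open>l\<close> products. The leaf stage is excluded: there an entry needs a row and a column,
  which may exceed \<open>l\<close> words.\<close>

lemma card_needs:
  assumes "z \<in> labels" "stage z \<noteq> d + 2"
  shows "card (needs z) \<le> l"
proof (cases z)
  case (Sub b p i j)
  have "card ((\<lambda>(a, c). Sub b r (a * h + i) (c * h + j)) ` ({..<q} \<times> {..<q})) \<le> l" for r h
  proof -
    have "card ((\<lambda>(a, c). Sub b r (a * h + i) (c * h + j)) ` ({..<q} \<times> {..<q})) \<le> card ({..<q} \<times> {..<q})"
      by (intro card_image_le) simp
    then show ?thesis using q_le_l by (simp add: card_cartesian_product power2_eq_square)
  qed
  then show ?thesis using Sub l_pos by (auto split: list.split)
next
  case (Prod p i k)
  then have "length p \<noteq> d" using assms by auto
  then show ?thesis using Prod card_image_le[of "{..<l}"] by simp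
qed (use l_pos in auto)

section \<open>Placement of the labels on the machines\<close>

definition init :: "nat \<Rightarrow> label list" where
  "init j = map (case_sum (\<lambda>(i, k). Inp True i k) (\<lambda>(i, k). Inp False i k)) (L j)"

lemma ex_init:
  assumes "y \<in> labels" "stage y = 0"
  shows "\<exists>j<l ^ d. y \<in> set (init j)"
proof -
  obtain b i k where y: "y = Inp b i k" "i < n" "k < n"
    using assms by (cases y) (auto simp: labels_def)
  define x where "x = (if b then Inl (i, k) else Inr (i, k))"
  have "x \<in> set (concat (map L [0..<l ^ d]))"
    using layout y unfolding mm_input_layout_def by (auto simp: x_def)
  then obtain j where "j < l ^ d" "x \<in> set (L j)" by auto
  moreover have "y = case_sum (\<lambda>(i, k). Inp True i k) (\<lambda>(i, k). Inp False i k) x"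
    by (simp add: x_def y)
  ultimately show ?thesis unfolding init_def by auto
qed

text \<open>Any balanced assignment will do except at the leaf products, which are placed by a
  bijection between leaves and machines. Of the last equivalence, one direction lets a machine's
  leaf products share their factors, the other gives a factor entry a single destination.\<close>

lemma ex_owner:
  obtains own where
    "\<And>y. y \<in> labels \<Longrightarrow> own y < l ^ d"
    "\<And>y. y \<in> labels \<Longrightarrow> stage y = 0 \<Longrightarrow> y \<in> set (init (own y))"
    "\<And>t j. t > 0 \<Longrightarrow> card {y \<in> labels. stage y = t \<and> own y = j} \<le> 2 * m\<^sup>2"
    "\<And>p r i k i' k'. p \<in> paths d \<Longrightarrow> r \<in> paths d \<Longrightarrow> own (Prod p i k) = own (Prod r i' k') \<longleftrightarrow> p = r"
proof -
  obtain g where g: "bij_betw g (paths d) {0..<l ^ d}"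
    using ex_bij_betw_finite_nat[OF card_paths(2)] card_paths(1) by metis
  then have g_inj: "p \<in> paths d \<Longrightarrow> r \<in> paths d \<Longrightarrow> g p = g r \<longleftrightarrow> p = r" for p r
    by (meson bij_betw_imp_inj_on inj_on_eq_iff)
  define P where "P t f \<longleftrightarrow> (t > 0 \<longrightarrow> (\<forall>y\<in>labels. stage y = t \<longrightarrow> f y < l ^ d) \<and>
      (\<forall>j. card {y \<in> labels. stage y = t \<and> f y = j} \<le> 2 * m\<^sup>2))" for t f
  have "\<exists>f. P t f" for t
  proof (cases "t > 0")
    case True
    have "finite {y \<in> labels. stage y = t}" using finite_labels by simp
    from ex_balanced_assignment[OF this card_stage[OF True]]
    obtain f where f: "\<forall>y\<in>{y \<in> labels. stage y = t}. f y < l ^ d"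
      "\<forall>j. card {y \<in> {y \<in> labels. stage y = t}. f y = j} \<le> 2 * m\<^sup>2" by blast
    have "P t f" using f by (simp add: P_def conj_assoc)
    then show ?thesis by blast
  qed (simp add: P_def)
  then have "\<forall>t. \<exists>f. P t f" ..
  from choice[OF this] obtain f where Pf: "\<forall>t. P t (f t)" ..
  have f: "y \<in> labels \<Longrightarrow> stage y = t \<Longrightarrow> f t y < l ^ d"
      "card {y \<in> labels. stage y = t \<and> f t y = j} \<le> 2 * m\<^sup>2" if "t > 0" for t y j
    using spec[OF Pf, of t] that by (simp_all add: P_def)
  \<comment> \<open>Inputs stay where the layout put them, leaf products follow the bijection
    \<open>g\<close>, and everything else the balanced assignment of its stage.\<close>
  define own where "own y = (case y of
      Inp b i j \<Rightarrow> SOME j. j < l ^ d \<and> y \<in> set (init j)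
    | Prod p i k \<Rightarrow> if length p = d then g p else f (stage y) y
    | _ \<Rightarrow> f (stage y) y)" for y
  have own_init: "own y < l ^ d \<and> y \<in> set (init (own y))" if y: "y \<in> labels" "stage y = 0" for y
    using someI_ex[OF ex_init[OF y]] that by (cases y) (auto simp: own_def labels_def)
  have own_inner: "own y = f (stage y) y" if "y \<in> labels" "stage y > 0" "stage y \<noteq> d + 2" for y
    using that by (cases y) (auto simp: own_def)
  have own_leaf: "\<exists>p\<in>paths d. own y = g p \<and> (\<exists>i<m. \<exists>k<m. y = Prod p i k)"
    if "y \<in> labels" "stage y = d + 2" for y
  proof (cases y)
    case (Prod p i k)
    then have len: "length p = d" using that by (auto simp: labels_def)
    then have "p \<in> paths d" "i < m" "k < m"
      using that(1) Prod by (simp_all add: labels_def side_last)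
    moreover have "own y = g p" by (simp add: own_def Prod len)
    ultimately show ?thesis using Prod by auto
  qed (use that in \<open>auto simp: labels_def\<close>)
  show ?thesis
  proof
    show "own y < l ^ d" if "y \<in> labels" for y
    proof -
      consider "stage y = 0" | "stage y = d + 2" | "stage y > 0" "stage y \<noteq> d + 2" by auto
      then show ?thesis
      proof cases
        case 2
        then show ?thesis using own_leaf[OF that] bij_betw_apply[OF g] by fastforce
      qed (use own_init own_inner f(1) that in auto)
    qed
    show "y \<in> set (init (own y))" if "y \<in> labels" "stage y = 0" for y
      using own_init that by auto
    show "own (Prod p i k) = own (Prod r i' k') \<longleftrightarrow> p = r"
      if "p \<in> paths d" "r \<in> paths d" for p r i k i' k'
    proof -
      have "length p = d" "length r = d" using that by (auto simp: paths_def)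
      then show ?thesis using g_inj[OF that] by (simp add: own_def)
    qed
    show "card {y \<in> labels. stage y = t \<and> own y = j} \<le> 2 * m\<^sup>2" (is "card ?Y \<le> _")
      if "t > 0" for t j
    proof (cases "t = d + 2")
      case False
      then have "?Y = {y \<in> labels. stage y = t \<and> f t y = j}"
        using own_inner that by auto
      then show ?thesis using f(2)[OF that] by simp
    next
      case True
      have "\<exists>p. ?Y \<subseteq> (\<lambda>(i, k). Prod p i k) ` ({..<m} \<times> {..<m})"
      proof (cases "j \<in> g ` paths d")
        case True
        then obtain p where p: "p \<in> paths d" "j = g p" by blast
        have "y \<in> (\<lambda>(i, k). Prod p i k) ` ({..<m} \<times> {..<m})" if "y \<in> ?Y" for y
        proof -
          have y: "y \<in> labels" "stage y = d + 2" "own y = j" using that \<open>t = d + 2\<close> by auto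
          from own_leaf[OF y(1,2)] obtain r i k
            where r: "r \<in> paths d" "own y = g r" "i < m" "k < m" "y = Prod r i k" by blast
          then have "r = p" using g_inj[OF r(1) p(1)] p(2) y(3) by simp
          then show ?thesis using r by auto
        qed
        then show ?thesis by blast
      next
        case False
        then have "y \<notin> ?Y" for y using own_leaf[of y] \<open>t = d + 2\<close> by fastforce
        then show ?thesis by blast
      qed
      then have "card ?Y \<le> card ({..<m} \<times> {..<m})"
        by (elim exE) (erule surj_card_le[rotated], simp)
      then show ?thesis by (simp add: card_cartesian_product power2_eq_square)
    qed
  qed
qed

section \<open>Values of the labels\<close>

primrec factor :: "(nat \<Rightarrow> nat \<times> nat \<Rightarrow> 'a) \<Rightarrow> 'a mat \<Rightarrow> nat list \<Rightarrow> 'a mat" where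
  "factor c A [] = pad_mat n (side 0) A"
| "factor c A (t # p) = mat_lincomb (side (Suc (length p))) ({..<q} \<times> {..<q}) (c t)
    (block (side (Suc (length p))) (factor c A p))"

lemma factor_carrier: "factor c A p \<in> carrier_mat (side (length p)) (side (length p))"
  by (cases p) (simp_all add: pad_mat_carrier mat_lincomb_def)

primrec word :: "'a mat \<Rightarrow> 'a mat \<Rightarrow> label \<Rightarrow> 'a" where
  "word A B (Inp b i j) = (if b then A else B) $$ (i, j)"
| "word A B (Sub b p i j) = (if b then factor \<alpha> A p else factor \<beta> B p) $$ (i, j)"
| "word A B (Prod p i k) = (factor \<alpha> A p * factor \<beta> B p) $$ (i, k)"
| "word A B (Outp i k) = (A * B) $$ (i, k)"

text \<open>The admissible valuations of the schedule: the labels get the values that an actual pair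
  of input matrices induces.\<close>

definition valuations :: "(label \<Rightarrow> 'a) set" where
  "valuations = {word A B | A B. A \<in> carrier_mat n n \<and> B \<in> carrier_mat n n}"

lemma word_Sub_Cons:
  assumes "i < side (Suc (length r))" "j < side (Suc (length r))"
  shows "word A B (Sub b (t # r) i j) = (\<Sum>s\<in>{..<q} \<times> {..<q}. (if b then \<alpha> else \<beta>) t s *
    word A B (Sub b r (fst s * side (Suc (length r)) + i) (snd s * side (Suc (length r)) + j)))"
  using assms by (simp add: mat_lincomb_def block_def)

lemma word_Prod_leaf:
  assumes "length p = d" "i < m" "k < m"
  shows "word A B (Prod p i k) = (\<Sum>j<m. word A B (Sub True p i j) * word A B (Sub False p j k))"
proof -
  have "factor \<alpha> A p \<in> carrier_mat m m" "factor \<beta> B p \<in> carrier_mat m m"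
    using factor_carrier[of _ _ p] assms(1) by (simp_all add: side_last)
  then show ?thesis using assms by (simp add: scalar_prod_def lessThan_atLeast0)
qed

text \<open>The factors at \<open>t # p\<close> are by definition the linear combinations formed by
  the \<open>t\<close>-th product, so this is one block step of the recursion.\<close>

lemma word_Prod_inner:
  assumes "length p < d" "i < side (length p)" "k < side (length p)"
  defines "h \<equiv> side (Suc (length p))"
  shows "word A B (Prod p i k) =
    (\<Sum>t<l. \<gamma> (i div h, k div h) t * word A B (Prod (t # p) (i mod h) (k mod h)))"
proof -
  have eq: "side (length p) = q * h" using side_Suc[OF assms(1)] by (simp add: h_def)
  then have "factor c C p \<in> carrier_mat (q * h) (q * h)" for c C
    using factor_carrier[of c C p] by simp
  from matmul_block_recursion[OF alg this this assms(2,3)[unfolded eq]] show ?thesis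
    by (simp only: word.simps factor.simps h_def)
qed

lemma word_Outp:
  assumes "A \<in> carrier_mat n n" "B \<in> carrier_mat n n" "i < n" "k < n"
  shows "word A B (Outp i k) = word A B (Prod [] i k)"
  using pad_mat_mult[OF assms(1,2) _ assms(3,4), of "side 0"] n_le by (simp add: side_def)

lemma expressible_label:
  assumes y: "y \<in> labels" "stage y > 0" and xs: "needs y \<subseteq> set xs"
  shows "expressible valuations xs (\<lambda>v. v y)"
proof (cases y)
  case (Inp b i j)
  then show ?thesis using y by simp
next
  case (Sub b p i j)
  show ?thesis
  proof (cases p)
    case Nil
    have ij: "i < side 0" "j < side 0" using y Sub Nil by (auto simp: labels_def)
    show ?thesis
    proof (cases "i < n \<and> j < n")
      case True
      then have "Inp b i j \<in> set xs" using xs Sub Nil by simp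
      then show ?thesis
        by (rule expressible_cong[OF expressible_member])
          (use ij True in \<open>auto simp: valuations_def Sub Nil pad_mat_def\<close>)
    next
      case False
      show ?thesis
        by (rule expressible_cong[OF expressible_const[of _ _ 0]])
          (use ij False in \<open>auto simp: valuations_def Sub Nil pad_mat_def\<close>)
    qed
  next
    case (Cons t r)
    let ?h = "side (Suc (length r))"
    let ?z = "\<lambda>s. Sub b r (fst s * ?h + i) (snd s * ?h + j)"
    have ij: "i < ?h" "j < ?h" using y Sub Cons by (auto simp: labels_def)
    have "?z s \<in> set xs" if "s \<in> {..<q} \<times> {..<q}" for s
      using that xs by (force simp: Sub Cons)
    then have "expressible valuations xs
        (\<lambda>v. \<Sum>s\<in>{..<q} \<times> {..<q}. (if b then \<alpha> else \<beta>) t s * v (?z s))"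
      by (intro expressible_sum expressible_mult expressible_const expressible_member)
    then show ?thesis
      by (rule expressible_cong) (auto simp only: valuations_def Sub Cons word_Sub_Cons[OF ij])
  qed
next
  case (Prod p i k)
  have ik: "i < side (length p)" "k < side (length p)" "length p \<le> d"
    using y Prod by (auto simp: labels_def)
  show ?thesis
  proof (cases "length p = d")
    case True
    have im: "i < m" "k < m" using ik True by (simp_all add: side_last)
    have "Sub True p i j \<in> set xs" "Sub False p j k \<in> set xs" if "j < m" for j
      using that xs True by (auto simp: Prod)
    then have "expressible valuations xs (\<lambda>v. \<Sum>j<m. v (Sub True p i j) * v (Sub False p j k))"
      by (intro expressible_sum expressible_mult expressible_member) auto
    then show ?thesis
      by (rule expressible_cong) (auto simp only: valuations_def Prod word_Prod_leaf[OF True im])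
  next
    case False
    let ?h = "side (Suc (length p))"
    have "Prod (t # p) (i mod ?h) (k mod ?h) \<in> set xs" if "t < l" for t
      using that xs False by (auto simp: Prod)
    then have "expressible valuations xs (\<lambda>v. \<Sum>t<l. \<gamma> (i div ?h, k div ?h) t *
        v (Prod (t # p) (i mod ?h) (k mod ?h)))"
      by (intro expressible_sum expressible_mult expressible_const expressible_member) auto
    moreover have "length p < d" using False ik(3) by simp
    ultimately show ?thesis
      using word_Prod_inner[OF _ ik(1,2)]
      by (elim expressible_cong) (auto simp only: valuations_def Prod)
  qed
next
  case (Outp i k)
  then have "Prod [] i k \<in> set xs" using xs by simp
  then show ?thesis
    by (rule expressible_cong[OF expressible_member])
      (use y in \<open>auto simp: valuations_def Outp labels_def word_Outp simp del: word.simps\<close>)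
qed

section \<open>Communication bounds and the resulting program\<close>

text \<open>Machines are counted, not labels. Stage 0 needs the sharper bound 1, since a machine may
  start with a full memory and has no factor \<open>l\<close> to spare when sending.\<close>

lemma card_targets:
  assumes own: "\<And>p i k i' k'. p \<in> paths d \<Longrightarrow> own (Prod p i k) = own (Prod p i' k')"
    and y: "y \<in> labels"
  shows "card (own ` {z \<in> labels. y \<in> needs z}) \<le> (if stage y = 0 then 1 else l)"
proof (cases y)
  case (Inp b i j)
  have "z = Sub b [] i j" if "z \<in> labels" "y \<in> needs z" for z
    using that by (cases z) (auto simp: Inp split: list.splits if_splits)
  then have "own ` {z \<in> labels. y \<in> needs z} \<subseteq> {own (Sub b [] i j)}" by auto
  from card_mono[OF _ this] show ?thesis using Inp by simp
next
  case (Sub b p i j)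
  show ?thesis
  proof (cases "length p = d")
    case True
    have "own z = own (Prod p 0 0)" if z: "z \<in> labels" "y \<in> needs z" for z
    proof (cases z)
      case z': (Prod p' i' k')
      then have "p' = p" using z(2) by (auto simp: Sub split: if_splits)
      moreover have "p \<in> paths d" using y True Sub by (simp add: labels_def)
      ultimately show ?thesis unfolding z' by (simp add: own)
    next
      case (Sub b' p' i' j')
      then show ?thesis
        using z True \<open>y = Sub b p i j\<close> by (cases p') (auto simp: labels_def split: if_splits)
    qed (use z Sub in auto)
    then have "own ` {z \<in> labels. y \<in> needs z} \<subseteq> {own (Prod p 0 0)}" by auto
    from card_mono[OF _ this] show ?thesis using Sub l_pos by simp
  next
    case False
    let ?h = "side (Suc (length p))"
    \<comment> \<open>In each of the \<open>l\<close> children the entry is used at one position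
      only, namely its position inside its block.\<close>
    have "z \<in> (\<lambda>t. Sub b (t # p) (i mod ?h) (j mod ?h)) ` {..<l}"
      if z: "z \<in> labels" "y \<in> needs z" for z
    proof (cases z)
      case z': (Sub b' p' i' j')
      then obtain t r where p': "p' = t # r" using z by (cases p') (auto simp: Sub split: if_splits)
      have "i' < side (length p')" "j' < side (length p')" "t < l"
        using z(1) by (auto simp: z' p' labels_def paths_def)
      then show ?thesis using z(2) by (auto simp: Sub z' p')
    qed (use z False in \<open>auto simp: Sub split: if_splits\<close>)
    then have "own ` {z \<in> labels. y \<in> needs z} \<subseteq> own ` (\<lambda>t. Sub b (t # p) (i mod ?h) (j mod ?h)) ` {..<l}"
      by blast
    then have "card (own ` {z \<in> labels. y \<in> needs z}) \<le> card {..<l}"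
      unfolding image_image by (rule surj_card_le[rotated]) simp
    then show ?thesis using Sub by simp
  qed
next
  case (Prod p i k)
  show ?thesis
  proof (cases p)
    case Nil
    have "z = Outp i k" if "z \<in> labels" "y \<in> needs z" for z
      using that by (cases z) (auto simp: Prod Nil split: list.splits if_splits)
    then have "own ` {z \<in> labels. y \<in> needs z} \<subseteq> {own (Outp i k)}" by auto
    from card_mono[OF _ this] show ?thesis using Prod l_pos by simp
  next
    case (Cons t r)
    let ?h = "side (length p)"
    \<comment> \<open>Conversely, an entry of a child product contributes to one entry in each of
      the \<open>q\<^sup>2\<close> blocks of the parent.\<close>
    have "z \<in> (\<lambda>(a, c). Prod r (a * ?h + i) (c * ?h + k)) ` ({..<q} \<times> {..<q})"
      if z: "z \<in> labels" "y \<in> needs z" for z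
    proof (cases z)
      case z': (Prod r' i' k')
      then have r': "r' = r" "i = i' mod ?h" "k = k' mod ?h"
        using z(2) by (auto simp: Prod Cons split: if_splits)
      have "length r < d" using z y by (auto simp: Prod Cons labels_def)
      then have "side (length r) = q * ?h" using side_Suc Cons by simp
      then have "i' < q * ?h" "k' < q * ?h" using z(1) by (auto simp: z' r' labels_def)
      then have "i' div ?h < q" "k' div ?h < q" by (simp_all add: less_mult_imp_div_less)
      then show ?thesis unfolding z' r' by (intro image_eqI[of _ _ "(i' div ?h, k' div ?h)"]) auto
    next
      case (Sub b' p' i' j')
      then show ?thesis using z by (auto simp: Prod split: list.splits if_splits)
    qed (use z Cons in \<open>auto simp: Prod\<close>)
    then have "own ` {z \<in> labels. y \<in> needs z} \<subseteq>
        own ` (\<lambda>(a, c). Prod r (a * ?h + i) (c * ?h + k)) ` ({..<q} \<times> {..<q})"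
      by blast
    then have "card (own ` {z \<in> labels. y \<in> needs z}) \<le> card ({..<q} \<times> {..<q})"
      unfolding image_image by (rule surj_card_le[rotated]) simp
    then show ?thesis using Prod q_le_l y by (simp add: labels_def power2_eq_square)
  qed
next
  case (Outp i k)
  have "y \<notin> needs z" for z
    by (cases z) (auto simp: Outp split: list.splits)
  then show ?thesis by simp
qed

lemma ex_schedule:
  "\<exists>own. oblivious_schedule (l ^ d) (2 * l * m\<^sup>2) labels stage own needs init valuations"
proof -
  obtain own where own: "\<And>y. y \<in> labels \<Longrightarrow> own y < l ^ d"
    "\<And>y. y \<in> labels \<Longrightarrow> stage y = 0 \<Longrightarrow> y \<in> set (init (own y))"
    "\<And>t j. t > 0 \<Longrightarrow> card {y \<in> labels. stage y = t \<and> own y = j} \<le> 2 * m\<^sup>2"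
    "\<And>p r i k i' k'. p \<in> paths d \<Longrightarrow> r \<in> paths d \<Longrightarrow> own (Prod p i k) = own (Prod r i' k') \<longleftrightarrow> p = r"
    by (rule ex_owner) (rule that)
  have init_length: "length (init j) \<le> 2 * l * m\<^sup>2" if "j < l ^ d" for j
    using layout that by (simp add: init_def mm_input_layout_def)
  have load: "card (\<Union>z\<in>{z \<in> labels. stage z = Suc t \<and> own z = j}. needs z) \<le> 2 * l * m\<^sup>2"
    (is "card (\<Union>z\<in>?Z. needs z) \<le> _") for t j
  proof (cases "Suc t = d + 2")
    case True
    have leaf: "\<exists>p\<in>paths d. \<exists>i<m. \<exists>k<m. z = Prod p i k" if "z \<in> ?Z" for z
    proof (cases z)
      case (Prod p i k)
      then have "length p = d" using that True by (auto simp: labels_def)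
      then show ?thesis using that Prod by (auto simp: labels_def side_last)
    qed (use that True in \<open>auto simp: labels_def\<close>)
    \<comment> \<open>All leaf products on a machine have the same path, so together they need no
      more than the two \<open>m \<times> m\<close> factors; adding up individual needs would give
      order \<open>m^3\<close>.\<close>
    have "\<exists>p. (\<Union>z\<in>?Z. needs z) \<subseteq> (\<lambda>(b, i, j). Sub b p i j) ` (UNIV \<times> {..<m} \<times> {..<m})"
    proof (cases "?Z = {}")
      case False
      then obtain z where z: "z \<in> ?Z" by blast
      from leaf[OF z] obtain p i k where p: "p \<in> paths d" "z = Prod p i k" by blast
      have "x \<in> (\<lambda>(b, i, j). Sub b p i j) ` (UNIV \<times> {..<m} \<times> {..<m})"
        if "z' \<in> ?Z" "x \<in> needs z'" for z' x
      proof -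
        from leaf[OF that(1)] obtain p' i' k' where
          p': "p' \<in> paths d" "i' < m" "k' < m" "z' = Prod p' i' k'" by blast
        have "own z = own z'" using z that(1) by simp
        then have "p' = p" using own(4)[OF p(1) p'(1)] p(2) p'(4) by simp
        moreover have "length p = d" using p(1) by (simp add: paths_def)
        ultimately show ?thesis using that(2) p' by (auto simp: image_iff)
      qed
      then show ?thesis by blast
    next
      case True
      show ?thesis unfolding True by simp
    qed
    then have "card (\<Union>z\<in>?Z. needs z) \<le> card ((UNIV :: bool set) \<times> {..<m} \<times> {..<m})"
      by (elim exE) (erule surj_card_le[rotated], simp)
    also have "\<dots> = 2 * m\<^sup>2" by (simp add: card_cartesian_product power2_eq_square)
    also have "\<dots> \<le> 2 * l * m\<^sup>2" using l_pos by simp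
    finally show ?thesis .
  next
    case False
    have "card (\<Union>z\<in>?Z. needs z) \<le> (\<Sum>z\<in>?Z. card (needs z))"
      using finite_labels by (intro card_UN_le) simp
    also have "\<dots> \<le> of_nat (card ?Z) * l"
      using False by (intro sum_bounded_above card_needs) auto
    also have "\<dots> \<le> 2 * m\<^sup>2 * l"
      using own(3)[of "Suc t" j] by (simp only: of_nat_id) (rule mult_le_mono1, simp)
    finally show ?thesis by (simp add: mult_ac)
  qed
  have send: "card (SIGMA y:{y \<in> labels. stage y = t \<and> own y = i}. own ` {z \<in> labels. y \<in> needs z})
      \<le> 2 * l * m\<^sup>2" (is "card (Sigma ?Y ?T) \<le> _") if "i < l ^ d" for t i
  proof -
    let ?c = "if t = 0 then 1 else l"
    have "card (Sigma ?Y ?T) = (\<Sum>y\<in>?Y. card (?T y))"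
      using finite_labels by (intro card_SigmaI) auto
    also have "\<dots> \<le> of_nat (card ?Y) * ?c"
      using card_targets[of own] own(4) by (intro sum_bounded_above) fastforce
    also have "\<dots> \<le> 2 * l * m\<^sup>2"
    proof (cases "t = 0")
      case True
      \<comment> \<open>An input label is owned by a machine that holds it initially, and it has one
        destination, so sending is bounded by the initial memory.\<close>
      then have "?Y \<subseteq> set (init i)" using own(2) by auto
      then have "card ?Y \<le> length (init i)"
        by (meson List.finite_set card_length card_mono le_trans)
      then show ?thesis using True init_length[OF that] by simp
    next
      case False
      then have "card ?Y * l \<le> 2 * m\<^sup>2 * l" using own(3)[of t i] by (intro mult_le_mono1) simp
      then show ?thesis using False by (simp add: mult_ac)
    qed
    finally show ?thesis .
  qed
  show ?thesis
    using finite_labels own(1,2) needs_label init_length load send expressible_label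
    by (intro exI[of _ own]; unfold_locales) blast+
qed

lemma ex_matmul_program:
  "\<exists>prog :: 'a mr_program. mr_computes_matmul n (l ^ d) (2 * l * m\<^sup>2) (2 * d + 3) L prog"
proof -
  obtain own where "oblivious_schedule (l ^ d) (2 * l * m\<^sup>2) labels stage own needs init valuations"
    using ex_schedule by blast
  then interpret oblivious_schedule "l ^ d" "2 * l * m\<^sup>2" labels stage own needs init valuations .
  define mem where "mem j = symbolic_memory (2 * d + 3) j" for j
  have "\<exists>pos. pos < length (mem (own (Outp i k))) \<and> mem (own (Outp i k)) ! pos = Prod [] i k"
    if "i < n" "k < n" for i k
  proof -
    have "Prod [] i k \<in> set (mem (own (Outp i k)))"
      using set_symbolic_memory_Suc[of "2 * d + 2"] that
      by (auto simp: mem_def numeral_3_eq_3 labels_def intro!: exI[of _ "Outp i k"])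
    then show ?thesis by (simp add: in_set_conv_nth)
  qed
  then obtain pos where pos: "\<And>i k. i < n \<Longrightarrow> k < n \<Longrightarrow> pos i k < length (mem (own (Outp i k)))"
    "\<And>i k. i < n \<Longrightarrow> k < n \<Longrightarrow> mem (own (Outp i k)) ! pos i k = Prod [] i k"
    by metis
  \<comment> \<open>The positions are read off the symbolic memory, hence are the same for all
    matrices.\<close>
  define loc where "loc = (\<lambda>(i, k). (own (Outp i k), pos i k))"
  have input: "mm_input A B L = (\<lambda>j. map (word A B) (init j))" for A B :: "'a mat"
    by (rule ext) (auto simp: mm_input_def init_def split: sum.split)
  have "mr_computes_matmul n (l ^ d) (2 * l * m\<^sup>2) (2 * d + 3) L program"
    unfolding mr_computes_matmul_def
  proof (intro conjI exI[of _ loc] ballI allI impI)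
    fix A B :: "'a mat" assume AB: "A \<in> carrier_mat n n" "B \<in> carrier_mat n n"
    then have V: "word A B \<in> valuations" by (auto simp: valuations_def)
    show "mr_within_bounds (l ^ d) (2 * l * m\<^sup>2) (2 * d + 3) program (mm_input A B L)"
      unfolding input by (rule mr_within_bounds_program[OF V])
    fix i k assume ik: "i < n" "k < n"
    have "own (Outp i k) < l ^ d" using ik by (intro own_less) (simp add: labels_def)
    moreover have "word A B (Prod [] i k) = (A * B) $$ (i, k)"
      using word_Outp[OF AB ik] by simp
    ultimately show "case loc (i, k) of (j, pos) \<Rightarrow> j < l ^ d \<and>
        pos < length (mr_memory (l ^ d) program (mm_input A B L) (2 * d + 3) j) \<and>
        mr_memory (l ^ d) program (mm_input A B L) (2 * d + 3) j ! pos = (A * B) $$ (i, k)"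
      using pos[OF ik] unfolding input mr_memory_program[OF V]
      by (simp add: loc_def mem_def del: word.simps)
  qed (rule local_computation_program)
  then show ?thesis by (intro exI[of _ program])
qed

end

section \<open>Parameters\<close>

definition leaf_side :: "real \<Rightarrow> nat \<Rightarrow> nat" where
  "leaf_side \<epsilon> n = nat \<lceil>real n powr (\<epsilon> / 2)\<rceil>"

text \<open>Minimality matters: one level less does not cover \<open>n\<close>, and this yields the
  upper bounds on both machines and rounds.\<close>

definition recursion_depth :: "real \<Rightarrow> nat \<Rightarrow> nat \<Rightarrow> nat" where
  "recursion_depth \<epsilon> q n = (LEAST d. n \<le> leaf_side \<epsilon> n * q ^ d)"

lemma leaf_side_bounds:
  assumes "n \<ge> 1" "\<epsilon> > 0"
  shows "leaf_side \<epsilon> n > 0" "real n powr (\<epsilon> / 2) \<le> real (leaf_side \<epsilon> n)"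
    "real (leaf_side \<epsilon> n) \<le> 2 * real n powr (\<epsilon> / 2)"
proof -
  have "real n powr (\<epsilon> / 2) \<ge> 1" using assms by (simp add: ge_one_powr_ge_zero)
  then show "leaf_side \<epsilon> n > 0" "real n powr (\<epsilon> / 2) \<le> real (leaf_side \<epsilon> n)"
    "real (leaf_side \<epsilon> n) \<le> 2 * real n powr (\<epsilon> / 2)"
    unfolding leaf_side_def by linarith+
qed

lemma le_leaf_side_power:
  assumes "q \<ge> 2" "n \<ge> 1" "\<epsilon> > 0"
  shows "n \<le> leaf_side \<epsilon> n * q ^ recursion_depth \<epsilon> q n"
  unfolding recursion_depth_def
proof (rule LeastI)
  have "n \<le> q ^ n" using assms(1) by (meson less_exp less_imp_le_nat le_trans power_mono zero_le)
  also have "\<dots> \<le> leaf_side \<epsilon> n * q ^ n" using leaf_side_bounds(1)[OF assms(2,3)] by simp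
  finally show "n \<le> leaf_side \<epsilon> n * q ^ n" .
qed

text \<open>Minimality gives \<open>q ^ (d - 1) < n / m\<close>, and the factor \<open>q\<close>
  pays for the last level. Depth 0 is excluded because for \<epsilon> > 2 the right-hand side may
  drop below 1.\<close>

lemma power_recursion_depth_le:
  assumes "q \<ge> 2" "n \<ge> 1" "\<epsilon> > 0" and d: "recursion_depth \<epsilon> q n > 0"
  shows "real q ^ recursion_depth \<epsilon> q n \<le> real q * real n powr (1 - \<epsilon> / 2)"
proof -
  obtain e where e: "recursion_depth \<epsilon> q n = Suc e" using d by (cases "recursion_depth \<epsilon> q n") auto
  then have "\<not> n \<le> leaf_side \<epsilon> n * q ^ e"
    unfolding recursion_depth_def by (metis lessI not_less_Least)
  then have "leaf_side \<epsilon> n * q ^ e < n" by simp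
  then have "real (leaf_side \<epsilon> n) * real q ^ e \<le> real n"
    by (metis less_imp_le_nat of_nat_le_iff of_nat_mult of_nat_power)
  moreover have "real n powr (\<epsilon> / 2) * real q ^ e \<le> real (leaf_side \<epsilon> n) * real q ^ e"
    using leaf_side_bounds[OF assms(2,3)] by (intro mult_right_mono) auto
  ultimately have "real n powr (\<epsilon> / 2) * real q ^ e \<le> real n" by linarith
  then have "real q ^ e \<le> real n / real n powr (\<epsilon> / 2)"
    using assms(2) by (simp add: field_simps)
  also have "\<dots> = real n powr (1 - \<epsilon> / 2)"
    using assms(2) by (simp add: powr_diff)
  finally show ?thesis using e by (simp add: mult_left_mono)
qed

lemma recursion_depth_le_ln:
  assumes "q \<ge> 2" "n \<ge> 1" "\<epsilon> > 0"
  shows "real (recursion_depth \<epsilon> q n) * ln 2 \<le> ln 2 + ln (real n)"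
proof (cases "recursion_depth \<epsilon> q n")
  case (Suc e)
  then have "\<not> n \<le> leaf_side \<epsilon> n * q ^ e"
    unfolding recursion_depth_def by (metis lessI not_less_Least)
  moreover have "q ^ e \<le> leaf_side \<epsilon> n * q ^ e" using leaf_side_bounds(1)[OF assms(2,3)] by simp
  moreover have "2 ^ e \<le> q ^ e" using assms(1) by (intro power_mono) auto
  ultimately have "2 ^ e \<le> n" by linarith
  then have "(2::real) ^ e \<le> real n" by (metis of_nat_le_iff of_nat_numeral of_nat_power)
  then have "ln ((2::real) ^ e) \<le> ln (real n)" by (intro ln_mono) auto
  then show ?thesis using Suc by (simp add: ln_realpow distrib_right)
qed (use assms in simp)

text \<open>With \<open>d\<close> the depth, \<open>l ^ d\<close> is at most
  \<open>(q ^ d) powr \<omega>\<close>. The maximum with 1 covers depth 0, where one machine remains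
  even if the exponent is negative.\<close>

lemma machines_bound:
  assumes q: "q \<ge> 2" and l: "1 \<le> l" "real l \<le> real q powr \<omega>" and n: "n \<ge> 1" "\<epsilon> > 0"
  shows "real (l ^ recursion_depth \<epsilon> q n) \<le>
    real q powr \<omega> * max 1 (real n powr (\<omega> * (2 - \<epsilon>) / 2))"
proof (cases "recursion_depth \<epsilon> q n = 0")
  case True
  have "1 * 1 \<le> real q powr \<omega> * max 1 (real n powr (\<omega> * (2 - \<epsilon>) / 2))"
    using l by (intro mult_mono) auto
  then show ?thesis using True by simp
next
  case False
  let ?d = "recursion_depth \<epsilon> q n"
  have "1 \<le> real q powr \<omega>" using l by linarith
  \<comment> \<open>The sign is what makes the power monotone in its base below.\<close>
  then have "0 \<le> \<omega>" using q by (auto simp: powr_less_one not_less[symmetric])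
  have "real (l ^ ?d) \<le> (real q powr \<omega>) ^ ?d"
    using l(2) by (simp add: power_mono)
  also have "\<dots> = (real q ^ ?d) powr \<omega>"
    using q by (simp add: powr_powr powr_realpow[symmetric] mult.commute)
  also have "\<dots> \<le> (real q * real n powr (1 - \<epsilon> / 2)) powr \<omega>"
    using power_recursion_depth_le[OF q n] False \<open>0 \<le> \<omega>\<close> by (intro powr_mono2) auto
  also have "\<dots> = real q powr \<omega> * real n powr (\<omega> * (2 - \<epsilon>) / 2)"
    by (simp add: powr_mult powr_powr algebra_simps diff_divide_distrib)
  also have "\<dots> \<le> real q powr \<omega> * max 1 (real n powr (\<omega> * (2 - \<epsilon>) / 2))"
    by (intro mult_left_mono) auto
  finally show ?thesis .
qed

lemma memory_bound:
  assumes "n \<ge> 1" "\<epsilon> > 0"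
  shows "real ((leaf_side \<epsilon> n)\<^sup>2) \<le> 4 * real n powr \<epsilon>"
proof -
  have "(real (leaf_side \<epsilon> n))\<^sup>2 \<le> (2 * real n powr (\<epsilon> / 2))\<^sup>2"
    using leaf_side_bounds(3)[OF assms] by (intro power_mono) auto
  also have "\<dots> = 4 * real n powr \<epsilon>"
    by (simp add: power2_eq_square mult_ac flip: powr_add)
  finally show ?thesis by simp
qed

text \<open>The constant is 2 + 5: twice the depth costs \<open>2 * ln n + 2 * ln 2\<close>, the
  extra rounds \<open>3 * ln 2\<close>, and \<open>ln 2 \<le> ln n\<close> since
  \<open>n \<ge> 2\<close>.\<close>

lemma rounds_bound:
  assumes "q \<ge> 2" "n \<ge> 2" "\<epsilon> > 0"
  shows "real (2 * recursion_depth \<epsilon> q n + 3) \<le> 7 / ln 2 * ln (real n)"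
proof -
  have "ln 2 \<le> ln (real n)" using assms(2) by (intro ln_mono) auto
  moreover have "real (recursion_depth \<epsilon> q n) * ln 2 \<le> ln 2 + ln (real n)"
    using assms by (intro recursion_depth_le_ln) auto
  ultimately have "real (2 * recursion_depth \<epsilon> q n + 3) * ln 2 \<le> 7 * ln (real n)"
    by (simp add: algebra_simps)
  then show ?thesis by (simp add: pos_le_divide_eq)
qed

text \<open>Both inputs fit into the machines together, so the statement about all input layouts is
  not vacuous.\<close>

lemma total_memory_bound:
  assumes q: "q \<ge> 2" "q\<^sup>2 \<le> l" and n: "n \<ge> 1" "\<epsilon> > 0"
  shows "2 * n\<^sup>2 \<le> l ^ recursion_depth \<epsilon> q n * (2 * l * (leaf_side \<epsilon> n)\<^sup>2)"
proof -
  let ?d = "recursion_depth \<epsilon> q n" and ?m = "leaf_side \<epsilon> n"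
  have "n\<^sup>2 \<le> (?m * q ^ ?d)\<^sup>2"
    using le_leaf_side_power[OF q(1) n] by (intro power_mono) auto
  also have "\<dots> = ?m\<^sup>2 * (q\<^sup>2) ^ ?d"
    by (simp add: power_mult_distrib mult.commute flip: power_mult)
  also have "\<dots> \<le> ?m\<^sup>2 * l ^ ?d" using q(2) by (intro mult_le_mono2 power_mono) auto
  also have "\<dots> \<le> ?m\<^sup>2 * l ^ ?d * l"
  proof -
    have "0 < q\<^sup>2" using q(1) by simp
    then have "l > 0" using q(2) by linarith
    then show ?thesis by simp
  qed
  finally show ?thesis by (simp add: mult_ac)
qed

theorem theorem4p1:
  fixes \<omega> \<epsilon> :: real and n0 l :: nat
    and \<alpha> \<beta> :: "nat \<Rightarrow> nat \<times> nat \<Rightarrow> 'a::field" and \<gamma> :: "nat \<times> nat \<Rightarrow> nat \<Rightarrow> 'a"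
  assumes "n0 \<ge> 2"
    and "bilinear_matmul_algorithm n0 n0 n0 l \<alpha> \<beta> \<gamma>"
    and "real l \<le> real n0 powr \<omega>"
    and "\<epsilon> > 0"
  shows "\<exists>machines memory rounds :: nat \<Rightarrow> nat.
    (\<lambda>n. real (machines n)) \<in> O(\<lambda>n. max 1 (real n powr (\<omega> * (2 - \<epsilon>) / 2))) \<and>
    (\<lambda>n. real (memory n)) \<in> O(\<lambda>n. real n powr \<epsilon>) \<and>
    (\<lambda>n. real (rounds n)) \<in> O(\<lambda>n. ln (real n)) \<and>
    (\<forall>n\<ge>1. 2 * n\<^sup>2 \<le> machines n * memory n \<and>
      (\<forall>L. mm_input_layout n (machines n) (memory n) L \<longrightarrow>
        (\<exists>prog :: 'a mr_program.
          mr_computes_matmul n (machines n) (memory n) (rounds n) L prog)))"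
proof -
  let ?d = "recursion_depth \<epsilon> n0" and ?m = "leaf_side \<epsilon>"
  have rank: "n0\<^sup>2 \<le> l" by (rule bilinear_matmul_algorithm_rank[OF assms(2)])
  moreover have "0 < n0\<^sup>2" using assms(1) by simp
  ultimately have l: "1 \<le> l" by linarith
  have "(\<lambda>n. real (l ^ ?d n)) \<in> O(\<lambda>n. max 1 (real n powr (\<omega> * (2 - \<epsilon>) / 2)))"
  proof (rule bigoI[of _ "real n0 powr \<omega>"])
    show "\<forall>\<^sub>F n in sequentially. norm (real (l ^ ?d n)) \<le>
        real n0 powr \<omega> * norm (max 1 (real n powr (\<omega> * (2 - \<epsilon>) / 2)))"
      using eventually_ge_at_top[of 1]
    proof eventually_elim
      case (elim n)
      then show ?case using machines_bound[OF assms(1) l assms(3) _ assms(4), of n] by simp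
    qed
  qed
  moreover have "(\<lambda>n. real (2 * l * (?m n)\<^sup>2)) \<in> O(\<lambda>n. real n powr \<epsilon>)"
  \<comment> \<open>The memory is \<open>2 * l\<close> times the square of the leaf side, and
    rounding the side up costs another factor 4.\<close>
  proof (rule bigoI[of _ "8 * real l"])
    show "\<forall>\<^sub>F n in sequentially. norm (real (2 * l * (?m n)\<^sup>2)) \<le> 8 * real l * norm (real n powr \<epsilon>)"
      using eventually_ge_at_top[of 1]
    proof eventually_elim
      case (elim n)
      have "2 * real l * real ((?m n)\<^sup>2) \<le> 2 * real l * (4 * real n powr \<epsilon>)"
        using elim by (intro mult_left_mono memory_bound assms) auto
      then show ?case by simp
    qed
  qed
  moreover have "(\<lambda>n. real (2 * ?d n + 3)) \<in> O(\<lambda>n. ln (real n))"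
  proof (rule bigoI[of _ "7 / ln 2"])
    show "\<forall>\<^sub>F n in sequentially. norm (real (2 * ?d n + 3)) \<le> 7 / ln 2 * norm (ln (real n))"
      using eventually_ge_at_top[of 2]
    proof eventually_elim
      case (elim n)
      then show ?case using rounds_bound[OF assms(1) _ assms(4), of n] by simp
    qed
  qed
  moreover have "2 * n\<^sup>2 \<le> l ^ ?d n * (2 * l * (?m n)\<^sup>2)" if "n \<ge> 1" for n
    by (rule total_memory_bound[OF assms(1) rank that assms(4)])
  moreover have "\<exists>prog :: 'a mr_program.
      mr_computes_matmul n (l ^ ?d n) (2 * l * (?m n)\<^sup>2) (2 * ?d n + 3) L prog"
    if "n \<ge> 1" "mm_input_layout n (l ^ ?d n) (2 * l * (?m n)\<^sup>2) L" for n L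
  proof -
    interpret matmul_network n0 l "?m n" "?d n" n \<alpha> \<beta> \<gamma> L
      using assms(1,2) that leaf_side_bounds(1)[OF that(1) assms(4)]
        le_leaf_side_power[OF assms(1) that(1) assms(4)]
      by unfold_locales auto
    show ?thesis by (rule ex_matmul_program)
  qed
  ultimately show ?thesis
    by (intro exI[of _ "\<lambda>n. l ^ ?d n"] exI[of _ "\<lambda>n. 2 * l * (?m n)\<^sup>2"] exI[of _ "\<lambda>n. 2 * ?d n + 3"]) blast
qed

end
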